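(* $\mathsf{FO}(\mathsf{TI}\mid\mathsf{FO})=\mathsf{FO}(\mathsf{TI})$.
   Context: Fix a countably infinite universe $U$. A database schema is a finite nonempty set of relation symbols with arities; facts are $R(u_1,\dots,u_{\mathrm{ar}(R)})$ with $u_i\in U$; an instance is a finite set of facts; $\mathrm{adom}(D)$ is the set of elements of $U$ occurring in $D$. A probabilistic database (PDB) is a discrete probability space $(\mathbb D,P)$ with $\mathbb D$ a nonempty countable set of instances over a schema. A PDB $\mathcal I$ is tuple-independent if for all pairwise distinct facts $f_1,\dots,f_k$, $\Pr_{I\sim\mathcal I}(f_1\in I,\dots,f_k\in I)=\prod_i\Pr_{I\sim\mathcal I}(f_i\in I)$; $\mathsf{TI}$ is the class of tuple-independent PDBs. For a PDB $\mathcal D=(\mathbb D,P)$ and a first-order sentence $\varphi$ (active domain semantics: quantifiers range over $\mathrm{adom}(D)$ together with the constants of $\varphi$) with $P(\{D:D\models\varphi\})>0$, the conditioned PDB $\mathcal D\mid\varphi$ has sample space $\mathbb D_\varphi=\{D\in\mathbb D: D\models\varphi\}$ and probabilities $P(\{D\})/P(\mathbb D_\varphi)$. $\mathsf{TI}\mid\mathsf{FO}$ is the class of all $\mathcal I\mid\varphi$ with $\mathcal I\in\mathsf{TI}$ and $\varphi$ a first-order sentence of positive probability. An FO-view consists of one first-order formula $\Phi_R(x_1,\dots,x_{\mathrm{ar}(R)})$ per output relation symbol $R$, evaluated under active domain semantics, mapping an instance $D$ to the instance containing $R(\bar a)$ for all tuples $\bar a$ over $\mathrm{adom}(D)\cup\mathrm{adom}(\Phi_R)$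 with $D\models\Phi_R[\bar a]$. The image of a PDB $(\mathbb D,P)$ under a view $V$ is the PDB on $V(\mathbb D)$ with $P'(\{D'\})=P(\{D:V(D)=D'\})$. For a class $\mathsf C$ of PDBs, $\mathsf{FO}(\mathsf C)$ is the class of images of members of $\mathsf C$ under FO-views. *)

theory Defs
  imports "HOL-Probability.Probability_Mass_Function" "HOL-Library.Countable_Set"
begin

type_synonym rsym = "nat \<times> nat"

definition ar :: "rsym \<Rightarrow> nat" where "ar R = snd R"

definition schema :: "rsym set \<Rightarrow> bool" where
  "schema S \<longleftrightarrow> finite S \<and> S \<noteq> {}"

type_synonym 'u fact = "rsym \<times> 'u list"
type_synonym 'u inst = "'u fact set"

definition fact_over :: "rsym set \<Rightarrow> 'u fact \<Rightarrow> bool" where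
  "fact_over S f \<longleftrightarrow> fst f \<in> S \<and> length (snd f) = ar (fst f)"

definition instance_over :: "rsym set \<Rightarrow> 'u inst \<Rightarrow> bool" where
  "instance_over S D \<longleftrightarrow> finite D \<and> (\<forall>f\<in>D. fact_over S f)"

definition adom :: "'u inst \<Rightarrow> 'u set" where
  "adom D = (\<Union>f\<in>D. set (snd f))"

datatype 'u trm = Var nat | Cst 'u

datatype 'u fml =
    Atm rsym "'u trm list"
  | Eq "'u trm" "'u trm"
  | Neg "'u fml"
  | Conj "'u fml" "'u fml"
  | Ex nat "'u fml"

fun fv_trm :: "'u trm \<Rightarrow> nat set" where
  "fv_trm (Var x) = {x}"
| "fv_trm (Cst c) = {}"

fun fv :: "'u fml \<Rightarrow> nat set" where
  "fv (Atm R ts) = (\<Union>t\<in>set ts. fv_trm t)"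
| "fv (Eq s t) = fv_trm s \<union> fv_trm t"
| "fv (Neg \<phi>) = fv \<phi>"
| "fv (Conj \<phi> \<psi>) = fv \<phi> \<union> fv \<psi>"
| "fv (Ex x \<phi>) = fv \<phi> - {x}"

fun fconsts_trm :: "'u trm \<Rightarrow> 'u set" where
  "fconsts_trm (Var x) = {}"
| "fconsts_trm (Cst c) = {c}"

fun fconsts :: "'u fml \<Rightarrow> 'u set" where
  "fconsts (Atm R ts) = (\<Union>t\<in>set ts. fconsts_trm t)"
| "fconsts (Eq s t) = fconsts_trm s \<union> fconsts_trm t"
| "fconsts (Neg \<phi>) = fconsts \<phi>"
| "fconsts (Conj \<phi> \<psi>) = fconsts \<phi> \<union> fconsts \<psi>"
| "fconsts (Ex x \<phi>) = fconsts \<phi>"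

fun eval_trm :: "(nat \<Rightarrow> 'u) \<Rightarrow> 'u trm \<Rightarrow> 'u" where
  "eval_trm v (Var x) = v x"
| "eval_trm v (Cst c) = c"

fun sat :: "'u set \<Rightarrow> 'u inst \<Rightarrow> 'u fml \<Rightarrow> (nat \<Rightarrow> 'u) \<Rightarrow> bool" where
  "sat A D (Atm R ts) v \<longleftrightarrow> (R, map (eval_trm v) ts) \<in> D"
| "sat A D (Eq s t) v \<longleftrightarrow> eval_trm v s = eval_trm v t"
| "sat A D (Neg \<phi>) v \<longleftrightarrow> \<not> sat A D \<phi> v"
| "sat A D (Conj \<phi> \<psi>) v \<longleftrightarrow> sat A D \<phi> v \<and> sat A D \<psi> v"
| "sat A D (Ex x \<phi>) v \<longleftrightarrow> (\<exists>a\<in>A. sat A D \<phi> (v(x := a)))"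

definition sentence :: "'u fml \<Rightarrow> bool" where
  "sentence \<phi> \<longleftrightarrow> fv \<phi> = {}"

definition models :: "'u inst \<Rightarrow> 'u fml \<Rightarrow> bool" where
  "models D \<phi> \<longleftrightarrow> sat (adom D \<union> fconsts \<phi>) D \<phi> (\<lambda>_. SOME a. True)"

text \<open>A PDB is a pair of a sample space (a set of instances) and a discrete probability
  distribution concentrated on it (the probability measure on the sample space is determined by
  its point masses).\<close>
type_synonym 'u pdb = "'u inst set \<times> 'u inst pmf"

definition is_pdb :: "'u pdb \<Rightarrow> bool" where
  "is_pdb I \<longleftrightarrow> fst I \<noteq> {} \<and> countable (fst I) \<and> set_pmf (snd I) \<subseteq> fst I \<and>
     (\<exists>S. schema S \<and> (\<forall>D\<in>fst I. instance_over S D))"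

definition tuple_independent :: "'u pdb \<Rightarrow> bool" where
  "tuple_independent I \<longleftrightarrow>
     (\<forall>F. finite F \<longrightarrow>
        measure_pmf.prob (snd I) {D. F \<subseteq> D} = (\<Prod>f\<in>F. measure_pmf.prob (snd I) {D. f \<in> D}))"

definition TI :: "'u pdb set" where
  "TI = {I. is_pdb I \<and> tuple_independent I}"

definition condition :: "'u pdb \<Rightarrow> 'u fml \<Rightarrow> 'u pdb" where
  "condition I \<phi> = ({D \<in> fst I. models D \<phi>}, cond_pmf (snd I) {D. models D \<phi>})"

definition TI_cond_FO :: "'u pdb set" where
  "TI_cond_FO = {condition I \<phi> | I \<phi>. I \<in> TI \<and> sentence \<phi> \<and>
                   measure_pmf.prob (snd I) {D \<in> fst I. models D \<phi>} > 0}"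

type_synonym 'u view = "rsym set \<times> (rsym \<Rightarrow> 'u fml)"

definition is_view :: "'u view \<Rightarrow> bool" where
  "is_view V \<longleftrightarrow> schema (fst V) \<and> (\<forall>R\<in>fst V. fv (snd V R) \<subseteq> {..<ar R})"

definition apply_view :: "'u view \<Rightarrow> 'u inst \<Rightarrow> 'u inst" where
  "apply_view V D = {(R, as) | R as. R \<in> fst V \<and> length as = ar R \<and>
      set as \<subseteq> adom D \<union> fconsts (snd V R) \<and>
      sat (adom D \<union> fconsts (snd V R)) D (snd V R) (\<lambda>i. as ! i)}"

definition image_pdb :: "'u view \<Rightarrow> 'u pdb \<Rightarrow> 'u pdb" where
  "image_pdb V I = (apply_view V ` fst I, map_pmf (apply_view V) (snd I))"

definition FO_img :: "'u pdb set \<Rightarrow> 'u pdb set" where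
  "FO_img C = {image_pdb V I | V I. is_view V \<and> I \<in> C}"

end

theory Submission
  imports Defs "HOL-Probability.Product_PMF"
begin

text \<open>Conditioning is simulated by rejection sampling with finitely many independent copies of the
  tuple-independent PDB \<open>I\<close>, living on disjoint relation symbols. Finitely many attempts may all
  fail, so one fixes an instance \<open>D0\<close> of positive probability with \<open>D0 \<Turnstile> \<phi>\<close> and writes \<open>I | \<phi>\<close> as
  the mixture of the point mass at \<open>D0\<close>, with weight \<open>a > 0\<close>, and \<open>I | \<phi> \<and> (I \<noteq> D0)\<close>. A view searches
  for the first copy that satisfies \<open>\<phi> \<and> (I \<noteq> D0)\<close>, which is first-order expressible, and outputs
  the image of \<open>D0\<close> if there is none. With enough copies the failure probability is at most \<open>a\<close>; an
  additional independent coin fact per copy, required for acceptance, makes it exactly \<open>a\<close>.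
  Formulas are evaluated on a single copy by relativising their quantifiers to its active domain.\<close>

section \<open>Disjoint copies of a schema\<close>

text \<open>\<open>ar\<close> reads the second component of a symbol, so the copy number has to be
  encoded into the first one.\<close>

definition ren :: "nat \<Rightarrow> rsym \<Rightarrow> rsym" where
  "ren i R = (prod_encode (i, fst R), snd R)"

definition tag :: "nat \<Rightarrow> 'u fact \<Rightarrow> 'u fact" where
  "tag i f = (ren i (fst f), snd f)"

lemma ren_eq_iff [simp]: "ren i R = ren j R' \<longleftrightarrow> i = j \<and> R = R'"
  by (auto simp: ren_def prod_eq_iff)

lemma ar_ren [simp]: "ar (ren i R) = ar R"
  by (simp add: ren_def ar_def)

lemma tag_eq_iff [simp]: "tag i f = tag j g \<longleftrightarrow> i = j \<and> f = g"
  by (cases f; cases g) (auto simp: tag_def)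

lemma inj_tag: "inj (tag i)"
  by (auto intro: injI)

lemma adom_vimage_tag: "adom (tag i -` G) \<subseteq> adom G"
  by (force simp: adom_def tag_def)

section \<open>Derived connectives, quantifier blocks, dependence on free variables\<close>

definition TT :: "'u fml" where
  "TT = Eq (Cst undefined) (Cst undefined)"

text \<open>Conjunction in an arbitrary order, meaningful for finite \<open>X\<close>. The closing
  \<open>TT\<close> brings in the constant \<open>undefined\<close>, which enlarges the active
  range; relativisation makes this harmless later.\<close>

definition Conjs :: "'b set \<Rightarrow> ('b \<Rightarrow> 'u fml) \<Rightarrow> 'u fml" where
  "Conjs X f = foldr (\<lambda>x. Conj (f x)) (SOME xs. set xs = X) TT"

definition Disj :: "'u fml \<Rightarrow> 'u fml \<Rightarrow> 'u fml" where
  "Disj \<phi> \<psi> = Neg (Conj (Neg \<phi>) (Neg \<psi>))"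

definition Disjs :: "'b set \<Rightarrow> ('b \<Rightarrow> 'u fml) \<Rightarrow> 'u fml" where
  "Disjs X f = Neg (Conjs X (\<lambda>x. Neg (f x)))"

fun Exs :: "nat \<Rightarrow> nat \<Rightarrow> 'u fml \<Rightarrow> 'u fml" where
  "Exs m 0 \<phi> = \<phi>"
| "Exs m (Suc k) \<phi> = Ex m (Exs (Suc m) k \<phi>)"

definition upd :: "nat \<Rightarrow> 'u list \<Rightarrow> (nat \<Rightarrow> 'u) \<Rightarrow> nat \<Rightarrow> 'u" where
  "upd m as v n = (if m \<le> n \<and> n < m + length as then as ! (n - m) else v n)"

lemma set_SOME_list: "finite X \<Longrightarrow> set (SOME xs. set xs = X) = X"
  by (rule someI_ex) (rule finite_list)

lemma sat_Conjs [simp]: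
  assumes "finite X"
  shows "sat A D (Conjs X f) v \<longleftrightarrow> (\<forall>x\<in>X. sat A D (f x) v)"
proof -
  have "sat A D (foldr (\<lambda>x. Conj (f x)) xs TT) v \<longleftrightarrow> (\<forall>x\<in>set xs. sat A D (f x) v)" for xs
    by (induction xs) (auto simp: TT_def)
  then show ?thesis
    by (simp add: Conjs_def set_SOME_list[OF assms])
qed

lemma fv_Conjs [simp]:
  assumes "finite X"
  shows "fv (Conjs X f) = (\<Union>x\<in>X. fv (f x))"
proof -
  have "fv (foldr (\<lambda>x. Conj (f x)) xs TT) = (\<Union>x\<in>set xs. fv (f x))" for xs
    by (induction xs) (auto simp: TT_def)
  then show ?thesis
    by (simp add: Conjs_def set_SOME_list[OF assms])
qed

text \<open>Only an inclusion, because of the constant of \<open>TT\<close>. It serves to force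
  given constants into the range of the quantifiers.\<close>

lemma fconsts_Conjs:
  assumes "finite X"
  shows "(\<Union>x\<in>X. fconsts (f x)) \<subseteq> fconsts (Conjs X f)"
proof -
  have "(\<Union>x\<in>set xs. fconsts (f x)) \<subseteq> fconsts (foldr (\<lambda>x. Conj (f x)) xs TT)" for xs
    by (induction xs) auto
  from this[of "SOME xs. set xs = X"] show ?thesis
    by (simp add: Conjs_def set_SOME_list[OF assms])
qed

lemma sat_Disj [simp]: "sat A D (Disj \<phi> \<psi>) v \<longleftrightarrow> sat A D \<phi> v \<or> sat A D \<psi> v"
  by (simp add: Disj_def)

lemma fv_Disj [simp]: "fv (Disj \<phi> \<psi>) = fv \<phi> \<union> fv \<psi>"
  by (simp add: Disj_def)

lemma sat_Disjs [simp]: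
  "finite X \<Longrightarrow> sat A D (Disjs X f) v \<longleftrightarrow> (\<exists>x\<in>X. sat A D (f x) v)"
  by (simp add: Disjs_def)

lemma fv_Disjs [simp]: "finite X \<Longrightarrow> fv (Disjs X f) = (\<Union>x\<in>X. fv (f x))"
  by (simp add: Disjs_def)

lemma upd_Cons: "upd m (a # as) v = upd (Suc m) as (v(m := a))"
  by (auto simp: upd_def fun_eq_iff nth_Cons' Suc_le_eq diff_Suc_less)

lemma sat_Exs [simp]:
  "sat A D (Exs m k \<phi>) v \<longleftrightarrow>
     (\<exists>as. length as = k \<and> set as \<subseteq> A \<and> sat A D \<phi> (upd m as v))"
proof (induction k arbitrary: m v)
  case 0
  have "upd m [] v = v" by (auto simp: upd_def fun_eq_iff)
  then show ?case by simp
next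
  case (Suc k)
  have "sat A D (Exs m (Suc k) \<phi>) v \<longleftrightarrow>
    (\<exists>a as. a \<in> A \<and> length as = k \<and> set as \<subseteq> A \<and> sat A D \<phi> (upd m (a # as) v))"
    unfolding Exs.simps sat.simps Suc.IH upd_Cons by blast
  also have "\<dots> \<longleftrightarrow> (\<exists>as. length as = Suc k \<and> set as \<subseteq> A \<and> sat A D \<phi> (upd m as v))"
  proof -
    have "\<exists>a cs. bs = a # cs \<and> a \<in> A \<and> length cs = k \<and> set cs \<subseteq> A"
      if "length bs = Suc k" "set bs \<subseteq> A" for bs
      using that by (cases bs) auto
    moreover have "length (a # as) = Suc k \<and> set (a # as) \<subseteq> A"
      if "a \<in> A" "length as = k" "set as \<subseteq> A" for a as
      using that by simp
    ultimately show ?thesis by metis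
  qed
  finally show ?case .
qed

lemma fv_Exs [simp]: "fv (Exs m k \<phi>) = fv \<phi> - {m..<m + k}"
  by (induction k arbitrary: m) auto

lemma map_upd_Var: "map (eval_trm (upd m as v)) (map Var [m..<m + length as]) = as"
  by (rule nth_equalityI) (auto simp: upd_def)

lemma eval_trm_cong: "(\<And>x. x \<in> fv_trm t \<Longrightarrow> v x = w x) \<Longrightarrow> eval_trm v t = eval_trm w t"
  by (cases t) auto

lemma sat_cong: "(\<And>x. x \<in> fv \<phi> \<Longrightarrow> v x = w x) \<Longrightarrow> sat A D \<phi> v \<longleftrightarrow> sat A D \<phi> w"
proof (induction \<phi> arbitrary: v w)
  case (Atm R ts)
  then have "map (eval_trm v) ts = map (eval_trm w) ts"
    by (auto intro!: eval_trm_cong)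
  then show ?case by (simp del: map_eq_conv)
next
  case (Eq s t)
  have "eval_trm v s = eval_trm w s" "eval_trm v t = eval_trm w t"
    using Eq by (auto intro!: eval_trm_cong)
  then show ?case by simp
next
  case (Neg \<phi>)
  have "sat A D \<phi> v \<longleftrightarrow> sat A D \<phi> w"
    using Neg.prems by (intro Neg.IH) simp
  then show ?case by simp
next
  case (Conj \<phi> \<psi>)
  have "sat A D \<phi> v \<longleftrightarrow> sat A D \<phi> w"
    using Conj.prems by (intro Conj.IH(1)) simp
  moreover have "sat A D \<psi> v \<longleftrightarrow> sat A D \<psi> w"
    using Conj.prems by (intro Conj.IH(2)) simp
  ultimately show ?case by simp
next
  case (Ex x \<phi>)
  have "sat A D \<phi> (v(x := a)) \<longleftrightarrow> sat A D \<phi> (w(x := a))" for a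
    using Ex.prems by (intro Ex.IH) auto
  then show ?case by simp
qed

lemma finite_fconsts_trm [simp]: "finite (fconsts_trm t)"
  by (cases t) auto

lemma finite_fconsts [simp]: "finite (fconsts \<phi>)"
  by (induction \<phi>) auto

section \<open>Relativisation to one copy\<close>

text \<open>An element is active in copy \<open>i\<close> if it fills some position \<open>j\<close>
  of some fact of that copy; finiteness of the schema makes this a finite disjunction. The tuple is
  bound from \<open>Suc x\<close> on, which keeps \<open>x\<close> itself from being
  captured.\<close>

definition in_dom :: "nat \<Rightarrow> rsym set \<Rightarrow> 'u set \<Rightarrow> nat \<Rightarrow> 'u fml" where
  "in_dom i S C x = Disj
     (Disjs (SIGMA R:S. {..<ar R}) (\<lambda>(R, j). Exs (Suc x) (ar R)
        (Conj (Atm (ren i R) (map Var [Suc x..<Suc x + ar R])) (Eq (Var x) (Var (Suc x + j))))))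
     (Disjs C (\<lambda>c. Eq (Var x) (Cst c)))"

text \<open>The tuple found by the quantifier block must lie in \<open>A\<close>, which
  \<open>adom G \<subseteq> A\<close> guarantees; its symbol and length are controlled because the
  copy is an instance over \<open>S\<close>.\<close>

lemma sat_in_dom:
  assumes "finite S" "finite C" "instance_over S (tag i -` G)" "adom G \<subseteq> A"
  shows "sat A G (in_dom i S C x) v \<longleftrightarrow> v x \<in> adom (tag i -` G) \<union> C"
proof -
  have "(\<exists>R\<in>S. \<exists>j<ar R. \<exists>as. length as = ar R \<and> set as \<subseteq> A \<and> (ren i R, as) \<in> G \<and> v x = as ! j)
      \<longleftrightarrow> v x \<in> adom (tag i -` G)" (is "?L \<longleftrightarrow> ?R")
  proof
    assume ?L
    then obtain R j as where "R \<in> S" "j < ar R" "length as = ar R" "set as \<subseteq> A" "(ren i R, as) \<in> G"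
        "v x = as ! j"
      by (elim bexE exE conjE)
    then have "(R, as) \<in> tag i -` G" "v x \<in> set (snd (R, as))"
      by (simp_all add: tag_def)
    then show ?R unfolding adom_def by blast
  next
    assume ?R
    then obtain f where "f \<in> tag i -` G" "v x \<in> set (snd f)"
      unfolding adom_def by blast
    then obtain R as where f: "tag i (R, as) \<in> G" "v x \<in> set as"
      by (cases f) auto
    then have "fact_over S (R, as)" "set as \<subseteq> A"
      using assms(3,4) by (force simp: instance_over_def adom_def tag_def)+
    then have "R \<in> S" "length as = ar R"
      by (simp_all add: fact_over_def)
    moreover from f obtain j where "j < length as" "v x = as ! j"
      by (metis in_set_conv_nth)
    moreover have "(ren i R, as) \<in> G"
      using f by (simp add: tag_def)
    ultimately show ?L
      using \<open>set as \<subseteq> A\<close> by (intro bexI[of _ R] exI[of _ j] exI[of _ as] conjI) simp_all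
  qed
  moreover have "sat A G (Exs (Suc x) (ar R)
        (Conj (Atm (ren i R) (map Var [Suc x..<Suc x + ar R])) (Eq (Var x) (Var (Suc x + j))))) v
      \<longleftrightarrow> (\<exists>as. length as = ar R \<and> set as \<subseteq> A \<and> (ren i R, as) \<in> G \<and> v x = as ! j)"
    if "j < ar R" for R j
    unfolding sat_Exs
  proof (intro ex_cong1 conj_cong refl)
    fix as :: "'a list" assume len: "length as = ar R"
    have "map (eval_trm (upd (Suc x) as v)) (map Var [Suc x..<Suc x + ar R]) = as"
      using map_upd_Var[of "Suc x" as v] unfolding len .
    moreover have "upd (Suc x) as v x = v x" "upd (Suc x) as v (Suc x + j) = as ! j"
      using \<open>j < ar R\<close> len by (auto simp: upd_def)
    ultimately show "sat A G (Conj (Atm (ren i R) (map Var [Suc x..<Suc x + ar R]))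
        (Eq (Var x) (Var (Suc x + j)))) (upd (Suc x) as v) \<longleftrightarrow> (ren i R, as) \<in> G \<and> v x = as ! j"
      by (simp only: sat.simps eval_trm.simps)
  qed
  then have "sat A G (Disjs (SIGMA R:S. {..<ar R}) (\<lambda>(R, j). Exs (Suc x) (ar R)
        (Conj (Atm (ren i R) (map Var [Suc x..<Suc x + ar R])) (Eq (Var x) (Var (Suc x + j)))))) v
      \<longleftrightarrow> (\<exists>R\<in>S. \<exists>j<ar R. \<exists>as. length as = ar R \<and> set as \<subseteq> A \<and> (ren i R, as) \<in> G \<and> v x = as ! j)"
    using assms(1) by (simp add: Bex_def split_paired_Ex del: sat_Exs upt_Suc) blast
  moreover have "sat A G (Disjs C (\<lambda>c. Eq (Var x) (Cst c))) v \<longleftrightarrow> v x \<in> C"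
    using assms(2) by auto
  ultimately show ?thesis
    unfolding in_dom_def sat_Disj by (simp only: Un_iff)
qed

lemma fv_in_dom: "finite S \<Longrightarrow> finite C \<Longrightarrow> fv (in_dom i S C x) \<subseteq> {x}"
  by (auto simp: in_dom_def)

fun relativise :: "nat \<Rightarrow> rsym set \<Rightarrow> 'u set \<Rightarrow> 'u fml \<Rightarrow> 'u fml" where
  "relativise i S C (Atm R ts) = Atm (ren i R) ts"
| "relativise i S C (Eq s t) = Eq s t"
| "relativise i S C (Neg \<phi>) = Neg (relativise i S C \<phi>)"
| "relativise i S C (Conj \<phi> \<psi>) = Conj (relativise i S C \<phi>) (relativise i S C \<psi>)"
| "relativise i S C (Ex x \<phi>) = Ex x (Conj (in_dom i S C x) (relativise i S C \<phi>))"

text \<open>The guard cuts each quantifier from \<open>A\<close> down to the range of the copy,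
  which is contained in \<open>A\<close>. As \<open>A\<close> may be any larger set, the result
  applies to a relativised formula inside a bigger one with further constants.\<close>

lemma sat_relativise:
  assumes "finite S" "finite C" "instance_over S (tag i -` G)" "adom G \<subseteq> A" "C \<subseteq> A"
  shows "sat A G (relativise i S C \<phi>) v \<longleftrightarrow> sat (adom (tag i -` G) \<union> C) (tag i -` G) \<phi> v"
proof (induction \<phi> arbitrary: v)
  case (Ex x \<phi>)
  moreover have "sat A G (in_dom i S C x) (v(x := a)) \<longleftrightarrow> a \<in> adom (tag i -` G) \<union> C" for a
    by (simp add: sat_in_dom[OF assms(1-4)])
  moreover have "adom (tag i -` G) \<union> C \<subseteq> A"
    using assms(4,5) adom_vimage_tag[of i G] by blast
  ultimately show ?case
    unfolding relativise.simps sat.simps by blast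
qed (auto simp: tag_def)

lemma fv_relativise:
  assumes "finite S" "finite C"
  shows "fv (relativise i S C \<phi>) \<subseteq> fv \<phi>"
  by (induction \<phi>) (use fv_in_dom[OF assms] in auto)

text \<open>Both inclusions between the copy and \<open>D\<close> are expressible since
  \<open>D\<close> and \<open>S\<close> are finite. The filter on the length matters: comparing the
  first \<open>ar R\<close> entries identifies only lists of that length.\<close>

definition is_inst :: "nat \<Rightarrow> rsym set \<Rightarrow> 'u inst \<Rightarrow> 'u fml" where
  "is_inst i S D = Conj
     (Conjs D (\<lambda>(R, as). Atm (ren i R) (map Cst as)))
     (Conjs S (\<lambda>R. Neg (Exs 0 (ar R) (Conj (Atm (ren i R) (map Var [0..<ar R]))
        (Conjs {as. (R, as) \<in> D \<and> length as = ar R}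
           (\<lambda>as. Neg (Conjs {..<ar R} (\<lambda>j. Eq (Var j) (Cst (as ! j))))))))))"

lemma finite_rel_section: "finite D \<Longrightarrow> finite {as. (R, as) \<in> D \<and> P as}"
  by (rule finite_subset[of _ "snd ` D"]) force+

lemma fv_is_inst:
  assumes "finite S" "finite D"
  shows "fv (is_inst i S D) = {}"
  using assms by (auto simp: is_inst_def finite_rel_section)

lemma sat_is_inst:
  assumes "finite S" "finite D" "instance_over S (tag i -` G)" "adom G \<subseteq> A"
  shows "sat A G (is_inst i S D) v \<longleftrightarrow> tag i -` G = D"
proof -
  have 1: "sat A G (Conjs D (\<lambda>(R, as). Atm (ren i R) (map Cst as))) v \<longleftrightarrow> D \<subseteq> tag i -` G"
    using assms(2) by (auto simp: tag_def comp_def)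
  have 2: "sat A G (Exs 0 (ar R) (Conj (Atm (ren i R) (map Var [0..<ar R]))
        (Conjs {as. (R, as) \<in> D \<and> length as = ar R}
           (\<lambda>as. Neg (Conjs {..<ar R} (\<lambda>j. Eq (Var j) (Cst (as ! j)))))))) v
     \<longleftrightarrow> (\<exists>as. length as = ar R \<and> set as \<subseteq> A \<and> (ren i R, as) \<in> G \<and> (R, as) \<notin> D)" for R
  proof -
    have "sat A G (Conj (Atm (ren i R) (map Var [0..<ar R]))
        (Conjs {as. (R, as) \<in> D \<and> length as = ar R}
           (\<lambda>as. Neg (Conjs {..<ar R} (\<lambda>j. Eq (Var j) (Cst (as ! j))))))) (upd 0 bs v)
      \<longleftrightarrow> (ren i R, bs) \<in> G \<and> (R, bs) \<notin> D" if bs: "length bs = ar R" for bs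
    proof -
      have "map (eval_trm (upd 0 bs v)) (map Var [0..<ar R]) = bs"
        using bs map_upd_Var[of 0 bs v] by simp
      moreover have "(\<forall>j\<in>{..<ar R}. upd 0 bs v j = as ! j) \<longleftrightarrow> as = bs"
        if "length as = ar R" for as
        using that bs by (auto simp: upd_def list_eq_iff_nth_eq)
      then have "(\<forall>as\<in>{as. (R, as) \<in> D \<and> length as = ar R}. \<not> (\<forall>j\<in>{..<ar R}. upd 0 bs v j = as ! j))
          \<longleftrightarrow> (R, bs) \<notin> D"
        using bs by blast
      ultimately show ?thesis
        using assms(2) by (simp add: finite_rel_section del: map_map)
    qed
    then show ?thesis
      unfolding sat_Exs by blast
  qed
  have "(\<forall>R\<in>S. \<not> (\<exists>as. length as = ar R \<and> set as \<subseteq> A \<and> (ren i R, as) \<in> G \<and> (R, as) \<notin> D))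
      \<longleftrightarrow> tag i -` G \<subseteq> D" (is "?L \<longleftrightarrow> ?R")
  proof
    assume L: ?L
    show ?R
    proof
      fix f assume f: "f \<in> tag i -` G"
      then have "fact_over S f" "set (snd f) \<subseteq> A"
        using assms(3,4) by (force simp: instance_over_def adom_def tag_def)+
      with L f show "f \<in> D" by (cases f) (auto simp: fact_over_def tag_def)
    qed
  qed (auto simp: tag_def)
  with 1 2 assms(1) show ?thesis
    unfolding is_inst_def sat.simps by (subst (2) sat_Conjs) (auto simp del: sat_Exs)
qed

section \<open>Operations preserving tuple-independence\<close>

definition ti_pmf :: "'u inst pmf \<Rightarrow> bool" where
  "ti_pmf p \<longleftrightarrow> (\<forall>F. finite F \<longrightarrow>
     measure_pmf.prob p {D. F \<subseteq> D} = (\<Prod>f\<in>F. measure_pmf.prob p {D. f \<in> D}))"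

lemma tuple_independent_iff: "tuple_independent I \<longleftrightarrow> ti_pmf (snd I)"
  by (simp add: tuple_independent_def ti_pmf_def)

lemma ti_pmf_return [simp]: "ti_pmf (return_pmf D)"
proof -
  have "indicator {D. F \<subseteq> D} D = (\<Prod>f\<in>F. indicator {D. f \<in> D} D :: real)" if "finite F" for F
    using that by (induction F) (auto simp: indicator_def)
  then show ?thesis
    by (simp add: ti_pmf_def)
qed

lemma ti_pmf_bernoulli:
  "ti_pmf (map_pmf (\<lambda>b. if b then {f} else {}) (bernoulli_pmf t))" (is "ti_pmf ?p")
  unfolding ti_pmf_def
proof (intro allI impI)
  fix F :: "'a inst" assume F: "finite F"
  consider "F \<subseteq> {f}" | g where "g \<in> F" "g \<noteq> f" by blast
  then show "measure_pmf.prob ?p {D. F \<subseteq> D} = (\<Prod>f\<in>F. measure_pmf.prob ?p {D. f \<in> D})"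
  proof cases
    case 1
    then have "F = {} \<or> F = {f}" by blast
    then show ?thesis by auto
  next
    case 2
    have *: "(\<lambda>b. if b then {f} else {}) -` {D. g \<in> D} = {}"
      "(\<lambda>b. if b then {f} else {}) -` {D. F \<subseteq> D} = {}"
      using 2 by (auto split: if_splits)
    then have "(\<Prod>f\<in>F. measure_pmf.prob ?p {D. f \<in> D}) = 0"
      using F 2 unfolding measure_map_pmf by (intro prod_zero) (auto intro!: bexI[of _ g])
    with * show ?thesis unfolding measure_map_pmf by simp
  qed
qed

text \<open>A set of facts inside the range of \<open>h\<close> is pulled back along
  \<open>h\<close>; a fact outside the range has probability 0, so both sides vanish.\<close>

lemma ti_pmf_image:
  fixes h :: "'u fact \<Rightarrow> 'v fact"
  assumes "inj h" "ti_pmf p"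
  shows "ti_pmf (map_pmf ((`) h) p)"
  unfolding ti_pmf_def
proof (intro allI impI)
  fix F :: "'v inst" assume F: "finite F"
  show "measure_pmf.prob (map_pmf ((`) h) p) {D. F \<subseteq> D} =
    (\<Prod>f\<in>F. measure_pmf.prob (map_pmf ((`) h) p) {D. f \<in> D})"
  proof (cases "F \<subseteq> range h")
    case True
    then obtain F' where F': "F = h ` F'" by (auto simp: subset_image_iff)
    have inj: "inj_on h F'" using assms(1) by (rule inj_on_subset) simp
    then have "finite F'" using F F' finite_imageD by blast
    then have "measure_pmf.prob p {D. F' \<subseteq> D} = (\<Prod>f\<in>F'. measure_pmf.prob p {D. f \<in> D})"
      using assms(2) by (simp add: ti_pmf_def)
    moreover have "(`) h -` {D. h ` F' \<subseteq> D} = {D. F' \<subseteq> D}" "(`) h -` {D. h f \<in> D} = {D. f \<in> D}" for f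
      using assms(1) by (auto simp: inj_image_subset_iff inj_image_mem_iff)
    ultimately show ?thesis
      by (simp add: F' prod.reindex[OF inj])
  next
    case False
    then obtain g where g: "g \<in> F" "g \<notin> range h" by blast
    have *: "(`) h -` {D. g \<in> D} = {}" "(`) h -` {D. F \<subseteq> D} = {}"
      using g by auto
    then have "(\<Prod>f\<in>F. measure_pmf.prob (map_pmf ((`) h) p) {D. f \<in> D}) = 0"
      using F g(1) unfolding measure_map_pmf by (intro prod_zero) (auto intro!: bexI[of _ g])
    with * show ?thesis unfolding measure_map_pmf by simp
  qed
qed

text \<open>The product rule for countable sets extends to all sets by intersecting with the
  supports, which are countable.\<close>

lemma prob_pair_pmf_Times:
  "measure_pmf.prob (pair_pmf p q) (A \<times> B) = measure_pmf.prob p A * measure_pmf.prob q B"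
proof -
  have "measure_pmf.prob (pair_pmf p q) (A \<times> B) =
      measure_pmf.prob (pair_pmf p q) ((A \<inter> set_pmf p) \<times> (B \<inter> set_pmf q))"
    by (rule measure_prob_cong_0) (auto simp: pmf_eq_0_set_pmf)
  then show ?thesis
    by (simp add: measure_pmf_prob_product countable_Int2 measure_Int_set_pmf)
qed

text \<open>The set \<open>X\<close> separates the facts of the two parts, so
  \<open>F \<subseteq> D \<union> E\<close> is the rectangle of
  \<open>F \<inter> X \<subseteq> D\<close> and \<open>F - X \<subseteq> E\<close>, and its
  probability factorises.\<close>

lemma ti_pmf_union:
  assumes "ti_pmf p" "ti_pmf q"
    and p: "\<And>D. D \<in> set_pmf p \<Longrightarrow> D \<subseteq> X" and q: "\<And>D. D \<in> set_pmf q \<Longrightarrow> D \<inter> X = {}"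
  shows "ti_pmf (map_pmf (\<lambda>(D, E). D \<union> E) (pair_pmf p q))" (is "ti_pmf ?r")
proof -
  have split: "measure_pmf.prob ?r {G. F \<subseteq> G} =
      measure_pmf.prob p {D. F \<inter> X \<subseteq> D} * measure_pmf.prob q {D. F - X \<subseteq> D}" for F
  proof -
    have "measure_pmf.prob ?r {G. F \<subseteq> G} =
        measure_pmf.prob (pair_pmf p q) ({D. F \<inter> X \<subseteq> D} \<times> {D. F - X \<subseteq> D})"
      unfolding measure_map_pmf
      by (rule measure_prob_cong_0) (use p q in \<open>fastforce simp: pmf_eq_0_set_pmf\<close>)+
    then show ?thesis by (simp add: prob_pair_pmf_Times)
  qed
  have single: "measure_pmf.prob ?r {G. f \<in> G} =
      (if f \<in> X then measure_pmf.prob p {D. f \<in> D} else measure_pmf.prob q {D. f \<in> D})" for f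
    using split[of "{f}"] by (simp add: Int_insert_left insert_Diff_if)
  show ?thesis
    unfolding ti_pmf_def
  proof (intro allI impI)
    fix F :: "'a inst" assume F: "finite F"
    have "(\<Prod>f\<in>F. measure_pmf.prob ?r {G. f \<in> G}) =
        (\<Prod>f\<in>F \<inter> X. measure_pmf.prob ?r {G. f \<in> G}) * (\<Prod>f\<in>F - X. measure_pmf.prob ?r {G. f \<in> G})"
      using F by (rule prod.Int_Diff)
    also have "\<dots> = measure_pmf.prob ?r {G. F \<subseteq> G}"
      unfolding split single using assms(1,2) F by (simp add: ti_pmf_def)
    finally show "measure_pmf.prob ?r {G. F \<subseteq> G} = (\<Prod>f\<in>F. measure_pmf.prob ?r {G. f \<in> G})"
      by simp
  qed
qed

section \<open>Two independent copies and a coin\<close>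

text \<open>Sample spaces are left out here; one is chosen only at the very end, among the instances
  over \<open>S\<close>.\<close>

definition ti_over :: "rsym set \<Rightarrow> 'u inst pmf \<Rightarrow> bool" where
  "ti_over S p \<longleftrightarrow> schema S \<and> ti_pmf p \<and> (\<forall>D\<in>set_pmf p. instance_over S D)"

definition coin :: "'u fact" where
  "coin = tag 2 ((0, 0), [])"

text \<open>\<open>E\<close> may itself be a merged instance. Nesting in this place lets three tags
  serve any number of rounds: \<open>D\<close> is the newest copy and \<open>E\<close> holds all
  earlier ones.\<close>

definition merge :: "bool \<Rightarrow> 'u inst \<Rightarrow> 'u inst \<Rightarrow> 'u inst" where
  "merge b D E = (if b then {coin} else {}) \<union> (tag 0 ` D \<union> tag 1 ` E)"

definition merge_schema :: "rsym set \<Rightarrow> rsym set \<Rightarrow> rsym set" where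
  "merge_schema S T = insert (ren 2 (0, 0)) (ren 0 ` S \<union> ren 1 ` T)"

definition merge_pmf :: "real \<Rightarrow> 'u inst pmf \<Rightarrow> 'u inst pmf \<Rightarrow> 'u inst pmf" where
  "merge_pmf b p q =
     map_pmf (\<lambda>(c, D, E). merge c D E) (pair_pmf (bernoulli_pmf b) (pair_pmf p q))"

lemma coin_in_merge [simp]: "coin \<in> merge b D E \<longleftrightarrow> b"
  by (auto simp: merge_def coin_def)

lemma vimage_tag_merge [simp]: "tag 0 -` merge b D E = D" "tag (Suc 0) -` merge b D E = E"
  by (auto simp: merge_def coin_def)

lemma schema_merge: "schema S \<Longrightarrow> schema T \<Longrightarrow> schema (merge_schema S T)"
  by (simp add: schema_def merge_schema_def)

lemma instance_over_merge:
  assumes "instance_over S D" "instance_over T E"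
  shows "instance_over (merge_schema S T) (merge b D E)"
  using assms unfolding instance_over_def merge_def merge_schema_def
  by (auto simp: fact_over_def tag_def coin_def) (simp add: ar_def ren_def)

lemma ti_pmf_merge:
  assumes "ti_pmf p" "ti_pmf q"
  shows "ti_pmf (merge_pmf b p q)"
proof -
  let ?c = "map_pmf (\<lambda>b. if b then {coin} else {}) (bernoulli_pmf b)"
  let ?pq = "map_pmf (\<lambda>(D, E). D \<union> E) (pair_pmf (map_pmf ((`) (tag 0)) p) (map_pmf ((`) (tag 1)) q))"
  have "merge_pmf b p q = map_pmf (\<lambda>(D, E). D \<union> E) (pair_pmf ?c ?pq)"
    by (simp add: merge_pmf_def merge_def pair_map_pmf1 pair_map_pmf2 map_pmf_comp case_prod_unfold)
  moreover have "ti_pmf ?pq"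
    by (rule ti_pmf_union[where X = "range (tag 0)"]) (auto intro!: ti_pmf_image inj_tag assms)
  ultimately show ?thesis
    by (auto intro!: ti_pmf_union[where X = "{coin}"] ti_pmf_bernoulli
        simp: coin_def split: if_splits)
qed

lemma ti_over_merge:
  assumes "ti_over S p" "ti_over T q"
  shows "ti_over (merge_schema S T) (merge_pmf b p q)"
  using assms unfolding ti_over_def
  by (auto intro: schema_merge ti_pmf_merge) (auto intro!: instance_over_merge simp: merge_pmf_def)

section \<open>The view that performs one round\<close>

definition choice_fml :: "rsym set \<Rightarrow> 'u fml \<Rightarrow> 'u inst \<Rightarrow> 'u fml" where
  "choice_fml S \<phi> D0 = Conj (Atm (ren 2 (0, 0)) [])
     (Conj (relativise 0 S (fconsts \<phi>) \<phi>) (Neg (is_inst 0 S D0)))"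

text \<open>A view outputs tuples over the range of its own formula. Inside the merged view that
  range is larger, so the guards on the output variables restore the original one.\<close>

definition output_fml :: "nat \<Rightarrow> rsym set \<Rightarrow> rsym \<Rightarrow> 'u fml \<Rightarrow> 'u fml" where
  "output_fml i S R \<psi> =
     Conj (relativise i S (fconsts \<psi>) \<psi>) (Conjs {..<ar R} (in_dom i S (fconsts \<psi>)))"

text \<open>The trivial equations put all constants of the three original formulas into the range of
  the quantifiers; the relativisations then cut that range back to the intended one.\<close>
definition merge_view ::
    "rsym set \<Rightarrow> rsym set \<Rightarrow> 'u fml \<Rightarrow> 'u inst \<Rightarrow> 'u view \<Rightarrow> 'u view \<Rightarrow> 'u view" where
  "merge_view S T \<phi> D0 V W = (fst V, \<lambda>R. Conj
     (Conjs (fconsts \<phi> \<union> fconsts (snd V R) \<union> fconsts (snd W R)) (\<lambda>c. Eq (Cst c) (Cst c)))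
     (Disj (Conj (choice_fml S \<phi> D0) (output_fml 0 S R (snd V R)))
           (Conj (Neg (choice_fml S \<phi> D0)) (output_fml 1 T R (snd W R)))))"

lemma fst_merge_view [simp]: "fst (merge_view S T \<phi> D0 V W) = fst V"
  by (simp add: merge_view_def)

lemma sat_choice_fml:
  assumes "finite S" "instance_over S (tag 0 -` G)" "adom G \<subseteq> A" "fconsts \<phi> \<subseteq> A"
    "finite D0" "sentence \<phi>"
  shows "sat A G (choice_fml S \<phi> D0) v \<longleftrightarrow>
    coin \<in> G \<and> models (tag 0 -` G) \<phi> \<and> tag 0 -` G \<noteq> D0"
proof -
  \<comment> \<open>A sentence does not depend on the assignment, so \<open>v\<close> may be
    exchanged for the one fixed in \<open>models\<close>.\<close>
  have "sat B D \<phi> v = sat B D \<phi> (\<lambda>_. SOME a. True)" for B D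
    using assms(6) by (intro sat_cong) (simp add: sentence_def)
  with assms show ?thesis
    by (simp add: choice_fml_def sat_relativise sat_is_inst models_def coin_def tag_def)
qed

lemma sat_output_fml:
  assumes "finite S" "instance_over S (tag i -` G)" "adom G \<subseteq> A" "fconsts \<psi> \<subseteq> A" "length as = ar R"
  shows "sat A G (output_fml i S R \<psi>) ((!) as) \<longleftrightarrow>
    set as \<subseteq> adom (tag i -` G) \<union> fconsts \<psi> \<and>
    sat (adom (tag i -` G) \<union> fconsts \<psi>) (tag i -` G) \<psi> ((!) as)"
proof -
  have "set as \<subseteq> X \<longleftrightarrow> (\<forall>j<ar R. as ! j \<in> X)" for X
    using assms(5) by (auto simp: set_conv_nth)
  then show ?thesis
    using assms(1-4) by (auto simp: output_fml_def sat_relativise sat_in_dom)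
qed

lemma fv_choice_fml:
  "finite S \<Longrightarrow> finite D0 \<Longrightarrow> sentence \<phi> \<Longrightarrow> fv (choice_fml S \<phi> D0) = {}"
  using fv_relativise[of S "fconsts \<phi>" 0 \<phi>]
  by (auto simp: choice_fml_def sentence_def fv_is_inst)

lemma fv_output_fml:
  assumes "finite S" "fv \<psi> \<subseteq> {..<ar R}"
  shows "fv (output_fml i S R \<psi>) \<subseteq> {..<ar R}"
proof -
  have "fv (relativise i S (fconsts \<psi>) \<psi>) \<subseteq> {..<ar R}"
    using fv_relativise[OF assms(1) finite_fconsts] assms(2) by blast
  moreover have "fv (in_dom i S (fconsts \<psi>) j) \<subseteq> {j}" for j
    using assms(1) by (simp add: fv_in_dom)
  ultimately show ?thesis
    by (fastforce simp: output_fml_def)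
qed

lemma is_view_merge:
  assumes "finite S" "finite T" "finite D0" "sentence \<phi>"
    and "is_view V" "is_view W" "fst W = fst V"
  shows "is_view (merge_view S T \<phi> D0 V W)"
proof -
  have "fv (output_fml i U R (snd X R)) \<subseteq> {..<ar R}"
    if "R \<in> fst V" "X \<in> {V, W}" "finite U" for i R X U
    using that assms by (intro fv_output_fml) (auto simp: is_view_def)
  then show ?thesis
    using assms by (auto simp: is_view_def merge_view_def fv_choice_fml)
qed

lemma apply_view_iff:
  "(R, as) \<in> apply_view V D \<longleftrightarrow> R \<in> fst V \<and> length as = ar R \<and>
     set as \<subseteq> adom D \<union> fconsts (snd V R) \<and>
     sat (adom D \<union> fconsts (snd V R)) D (snd V R) ((!) as)"
  by (cases R) (auto simp: apply_view_def)

text \<open>Each branch is relativised to one copy and guards its output tuples, so neither elements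
  of the other copy nor added constants influence the result.\<close>

lemma apply_merge_view:
  assumes "finite S" "finite T" "finite D0" "sentence \<phi>" "fst W = fst V"
    and D: "instance_over S D" and E: "instance_over T E"
  shows "apply_view (merge_view S T \<phi> D0 V W) (merge b D E) =
    (if b \<and> models D \<phi> \<and> D \<noteq> D0 then apply_view V D else apply_view W E)"
proof (rule set_eqI, clarify)
  fix R :: rsym and as :: "'a list"
  let ?U = "merge_view S T \<phi> D0 V W" and ?G = "merge b D E"
  let ?A = "adom ?G \<union> fconsts (snd ?U R)"
  have "fconsts \<phi> \<union> fconsts (snd V R) \<union> fconsts (snd W R) \<subseteq> fconsts (snd ?U R)"
    using fconsts_Conjs[of "fconsts \<phi> \<union> fconsts (snd V R) \<union> fconsts (snd W R)" "\<lambda>c. Eq (Cst c) (Cst c)"]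
    by (simp add: merge_view_def) blast
  then have C: "fconsts \<phi> \<subseteq> ?A" "fconsts (snd V R) \<subseteq> ?A" "fconsts (snd W R) \<subseteq> ?A"
    by blast+
  \<comment> \<open>With \<open>C\<close>, this makes the bound \<open>set as \<subseteq> ?A\<close>
    imposed by the merged view a consequence of the narrower bound of the selected branch.\<close>
  have sub: "adom D \<subseteq> ?A" "adom E \<subseteq> ?A"
    using adom_vimage_tag[of 0 ?G] adom_vimage_tag[of 1 ?G] by auto
  have "sat ?A ?G (snd ?U R) ((!) as) \<longleftrightarrow>
     (if b \<and> models D \<phi> \<and> D \<noteq> D0
      then set as \<subseteq> adom D \<union> fconsts (snd V R) \<and> sat (adom D \<union> fconsts (snd V R)) D (snd V R) ((!) as)
      else set as \<subseteq> adom E \<union> fconsts (snd W R) \<and> sat (adom E \<union> fconsts (snd W R)) E (snd W R) ((!) as))"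
    if "length as = ar R"
  proof -
    have "sat ?A ?G (choice_fml S \<phi> D0) ((!) as) \<longleftrightarrow> b \<and> models D \<phi> \<and> D \<noteq> D0"
      using sat_choice_fml[of S ?G ?A] assms C by simp
    moreover have "sat ?A ?G (output_fml 0 S R (snd V R)) ((!) as) \<longleftrightarrow>
        set as \<subseteq> adom D \<union> fconsts (snd V R) \<and> sat (adom D \<union> fconsts (snd V R)) D (snd V R) ((!) as)"
      using sat_output_fml[of S 0 ?G ?A] assms C that by simp
    moreover have "sat ?A ?G (output_fml 1 T R (snd W R)) ((!) as) \<longleftrightarrow>
        set as \<subseteq> adom E \<union> fconsts (snd W R) \<and> sat (adom E \<union> fconsts (snd W R)) E (snd W R) ((!) as)"
      using sat_output_fml[of T 1 ?G ?A] assms C that by simp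
    moreover have "sat ?A ?G (snd ?U R) ((!) as) \<longleftrightarrow>
        (if sat ?A ?G (choice_fml S \<phi> D0) ((!) as) then sat ?A ?G (output_fml 0 S R (snd V R)) ((!) as)
         else sat ?A ?G (output_fml 1 T R (snd W R)) ((!) as))"
      by (subst (2) merge_view_def) simp
    ultimately show ?thesis by (simp only:)
  qed
  note sat_U = this
  have len: "(R, as) \<in> apply_view ?U ?G \<longleftrightarrow> R \<in> fst V \<and> length as = ar R \<and> set as \<subseteq> ?A \<and>
      sat ?A ?G (snd ?U R) ((!) as)"
    by (simp add: apply_view_iff)
  show "(R, as) \<in> apply_view ?U ?G \<longleftrightarrow>
      (R, as) \<in> (if b \<and> models D \<phi> \<and> D \<noteq> D0 then apply_view V D else apply_view W E)"
  proof (cases "b \<and> models D \<phi> \<and> D \<noteq> D0")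
    case True
    have "adom D \<union> fconsts (snd V R) \<subseteq> ?A" using C sub by blast
    then show ?thesis
      unfolding len if_P[OF True] apply_view_iff[of R as V] using sat_U[unfolded if_P[OF True]] by blast
  next
    case False
    have "adom E \<union> fconsts (snd W R) \<subseteq> ?A" using C sub by blast
    then show ?thesis
      unfolding len if_not_P[OF False] apply_view_iff[of R as W] assms(5)
      using sat_U[unfolded if_not_P[OF False]] by blast
  qed
qed

section \<open>Mixtures and a single round of rejection sampling\<close>

definition mix :: "real \<Rightarrow> 'a pmf \<Rightarrow> 'a pmf \<Rightarrow> 'a pmf" where
  "mix t p q = bind_pmf (bernoulli_pmf t) (\<lambda>b. if b then p else q)"

lemma pmf_mix: "0 \<le> t \<Longrightarrow> t \<le> 1 \<Longrightarrow> pmf (mix t p q) x = t * pmf p x + (1 - t) * pmf q x"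
  by (simp add: mix_def pmf_bind)

text \<open>Acceptance means that the coin shows and \<open>D \<in> A\<close>; its probability is
  \<open>b\<close> times that of \<open>A\<close>, and given acceptance \<open>D\<close> is
  distributed as \<open>p\<close> conditioned on \<open>A\<close>. All other mass is passed on to
  \<open>q\<close>.\<close>

lemma bind_bernoulli_accept_eq_mix:
  assumes "0 \<le> b" "b \<le> 1" "set_pmf p \<inter> A \<noteq> {}"
  shows "bind_pmf (bernoulli_pmf b)
      (\<lambda>c. bind_pmf p (\<lambda>D. if c \<and> D \<in> A then return_pmf (f D) else q)) =
    mix (b * measure_pmf.prob p A) (map_pmf f (cond_pmf p A)) q" (is "?l = ?r")
proof (rule pmf_eqI)
  fix z
  let ?s = "measure_pmf.prob p A"
  have s: "?s > 0"
    using assms(3) by (auto intro: measure_pmf_posI)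
  have "measure_pmf.prob (cond_pmf p A) (f -` {z}) = measure_pmf.prob p (A \<inter> f -` {z}) / ?s"
    using s measure_pmf.emeasure_eq_measure[of p A]
    unfolding cond_pmf.rep_eq[OF assms(3)] by (subst measure_uniform_measure) auto
  then have cond: "?s * pmf (map_pmf f (cond_pmf p A)) z = measure_pmf.prob p (A \<inter> f -` {z})"
    using s by (simp add: pmf_map)
  have "pmf (bind_pmf p (\<lambda>D. if D \<in> A then return_pmf (f D) else q)) z =
      (\<integral>D. indicator (A \<inter> f -` {z}) D + pmf q z * indicator (- A) D \<partial>measure_pmf p)"
    unfolding pmf_bind by (intro Bochner_Integration.integral_cong) (auto simp: indicator_def)
  also have "\<dots> = measure_pmf.prob p (A \<inter> f -` {z}) + pmf q z * measure_pmf.prob p (- A)"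
    by (subst Bochner_Integration.integral_add) (auto simp: integrable_real_indicator measure_pmf.emeasure_eq_measure)
  also have "measure_pmf.prob p (- A) = 1 - ?s"
    using measure_pmf.prob_compl[of A p] by (simp add: Compl_eq_Diff_UNIV)
  finally have "pmf (bind_pmf p (\<lambda>D. if D \<in> A then return_pmf (f D) else q)) z =
      ?s * pmf (map_pmf f (cond_pmf p A)) z + pmf q z * (1 - ?s)"
    by (simp add: cond)
  moreover have "b * ?s \<le> 1"
    using assms s by (simp add: mult_le_one)
  moreover have "pmf ?l z = b * pmf (bind_pmf p (\<lambda>D. if D \<in> A then return_pmf (f D) else q)) z +
      (1 - b) * pmf q z"
    using assms(1,2) by (simp add: pmf_bind[of "bernoulli_pmf b"])
  ultimately show "pmf ?l z = pmf ?r z"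
    using assms(1) s by (simp add: pmf_mix) (simp add: algebra_simps)
qed

text \<open>One round of rejection sampling. The last conclusion is about sample spaces only: it
  reaches the outputs of instances of probability \<open>0\<close>.\<close>
lemma merge_step:
  assumes p: "ti_over S p" and q: "ti_over T q"
    and V: "is_view V" and W: "is_view W" "fst W = fst V"
    and \<phi>: "sentence \<phi>" and D0: "finite D0" and b: "0 \<le> b" "b \<le> 1"
    and A: "A = {D. models D \<phi>} - {D0}" "set_pmf p \<inter> A \<noteq> {}"
  obtains S' r U where "ti_over S' r" "is_view U" "fst U = fst V"
    "map_pmf (apply_view U) r =
       mix (b * measure_pmf.prob p A) (map_pmf (apply_view V) (cond_pmf p A)) (map_pmf (apply_view W) q)"
    "\<And>D. instance_over S D \<Longrightarrow> D \<in> A \<Longrightarrow> \<exists>G. instance_over S' G \<and> apply_view U G = apply_view V D"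
proof -
  let ?U = "merge_view S T \<phi> D0 V W"
  have fin: "finite S" "finite T"
    using p q by (simp_all add: ti_over_def schema_def)
  have U: "apply_view ?U (merge c D E) = (if c \<and> D \<in> A then apply_view V D else apply_view W E)"
    if "instance_over S D" "instance_over T E" for c D E
    using apply_merge_view[OF fin D0 \<phi> W(2) that] A(1) by auto
  have "map_pmf (apply_view ?U) (merge_pmf b p q) =
      bind_pmf (bernoulli_pmf b) (\<lambda>c. bind_pmf p (\<lambda>D. bind_pmf q (\<lambda>E. return_pmf (apply_view ?U (merge c D E)))))"
    by (simp add: merge_pmf_def pair_pmf_def map_bind_pmf bind_return_pmf bind_assoc_pmf)
  \<comment> \<open>Integrates out the second copy: an accepted output does not depend on
    \<open>E\<close>, a rejected one depends on nothing else.\<close>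
  also have "\<dots> = bind_pmf (bernoulli_pmf b) (\<lambda>c. bind_pmf p
      (\<lambda>D. if c \<and> D \<in> A then return_pmf (apply_view V D) else map_pmf (apply_view W) q))"
  proof (intro bind_pmf_cong refl)
    fix c D assume D: "D \<in> set_pmf p"
    have "bind_pmf q (\<lambda>E. return_pmf (apply_view ?U (merge c D E))) =
        bind_pmf q (\<lambda>E. return_pmf (if c \<and> D \<in> A then apply_view V D else apply_view W E))"
      using p q D by (intro bind_pmf_cong refl) (auto simp: U ti_over_def)
    then show "bind_pmf q (\<lambda>E. return_pmf (apply_view ?U (merge c D E))) =
        (if c \<and> D \<in> A then return_pmf (apply_view V D) else map_pmf (apply_view W) q)"
      by (cases "c \<and> D \<in> A") (auto simp: map_pmf_def)
  qed
  also have "\<dots> = mix (b * measure_pmf.prob p A) (map_pmf (apply_view V) (cond_pmf p A))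
      (map_pmf (apply_view W) q)"
    using b A(2) by (rule bind_bernoulli_accept_eq_mix)
  finally have "map_pmf (apply_view ?U) (merge_pmf b p q) =
      mix (b * measure_pmf.prob p A) (map_pmf (apply_view V) (cond_pmf p A)) (map_pmf (apply_view W) q)" .
  moreover have "\<exists>G. instance_over (merge_schema S T) G \<and> apply_view ?U G = apply_view V D"
    if "instance_over S D" "D \<in> A" for D
  proof -
    \<comment> \<open>An accepted output ignores the second copy, so any instance over
      \<open>T\<close> will do there, such as the empty one, together with a present coin.\<close>
    have "instance_over T {}" by (simp add: instance_over_def)
    then show ?thesis
      using that instance_over_merge[of S D T "{}" True] U[of D "{}" True] by auto
  qed
  ultimately show ?thesis
    using that[of "merge_schema S T" "merge_pmf b p q" ?U] p q
    by (simp add: ti_over_merge is_view_merge fin D0 \<phi> V W)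
qed

section \<open>Splitting off a point mass and iterating the rounds\<close>

text \<open>The case in which nothing remains beside \<open>D0\<close>: the conditioned distribution
  is a point mass, where every fact has probability 0 or 1. The sample space may still be larger
  than \<open>{D0}\<close>.\<close>

lemma condition_point_mass_in_TI:
  assumes I: "I \<in> TI" and sub: "set_pmf (snd I) \<inter> {D. models D \<phi>} = {D0}"
  shows "condition I \<phi> \<in> TI"
proof -
  have "set_pmf (cond_pmf (snd I) {D. models D \<phi>}) = {D0}"
    using sub by (subst set_cond_pmf) auto
  then have "cond_pmf (snd I) {D. models D \<phi>} = return_pmf D0"
    by (simp add: set_pmf_subset_singleton[symmetric])
  moreover have "D0 \<in> fst I" "models D0 \<phi>" "countable (fst I)"
    "\<exists>S. schema S \<and> (\<forall>D\<in>fst I. instance_over S D)"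
    using I sub by (auto simp: TI_def is_pdb_def)
  ultimately show ?thesis
    by (auto simp: TI_def condition_def is_pdb_def tuple_independent_iff
        intro: countable_subset[of _ "fst I"])
qed

lemma pmf_map_cond_split:
  assumes x: "x \<in> set_pmf p" "x \<in> B" and ne: "set_pmf p \<inter> (B - {x}) \<noteq> {}"
  defines "a \<equiv> pmf p x / measure_pmf.prob p B"
  shows "map_pmf f (cond_pmf p B) = mix a (return_pmf (f x)) (map_pmf f (cond_pmf p (B - {x})))"
    and "0 < a" "a < 1"
proof -
  let ?s = "measure_pmf.prob p (B - {x})"
  have B: "set_pmf p \<inter> B \<noteq> {}" using x by blast
  have s: "measure_pmf.prob p B = pmf p x + ?s"
    using measure_pmf.finite_measure_Union[of "{x}" p "B - {x}"] x(2)
    by (simp add: measure_pmf_single insert_absorb)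
  have pos: "pmf p x > 0" "?s > 0"
    using x ne by (auto simp: pmf_positive intro: measure_pmf_posI)
  then show a: "0 < a" "a < 1"
    by (simp_all add: a_def s)
  have "cond_pmf p B = mix a (return_pmf x) (cond_pmf p (B - {x}))"
  proof (rule pmf_eqI)
    fix y
    have "1 - a = ?s / measure_pmf.prob p B"
      using pos by (simp add: a_def s field_simps)
    then show "pmf (cond_pmf p B) y = pmf (mix a (return_pmf x) (cond_pmf p (B - {x}))) y"
      using a pos x(2) by (auto simp: pmf_mix pmf_cond[OF B] pmf_cond[OF ne] a_def)
  qed
  then show "map_pmf f (cond_pmf p B) = mix a (return_pmf (f x)) (map_pmf f (cond_pmf p (B - {x})))"
    by (simp add: mix_def map_bind_pmf if_distrib[of "map_pmf f"] cong: if_cong)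
qed

text \<open>\<open>q\<close> is reached only if the first choice rejects \<open>p\<close> and the
  second selects \<open>q\<close>.\<close>

lemma mix_mix:
  assumes "0 \<le> t" "t \<le> 1" "0 \<le> a" "a \<le> 1"
  shows "mix t p (mix a q p) = mix ((1 - t) * a) q p"
proof (rule pmf_eqI)
  fix x
  have "(1 - t) * a \<le> 1" using assms by (simp add: mult_le_one)
  then show "pmf (mix t p (mix a q p)) x = pmf (mix ((1 - t) * a) q p) x"
    using assms by (simp add: pmf_mix) (simp add: algebra_simps)
qed

text \<open>Starting from certain failure, each further round multiplies the weight of the output
  for \<open>D0\<close> by the same factor, until that weight equals the share \<open>a\<close> of
  \<open>D0\<close> in the conditioned distribution.\<close>

lemma representable_conditioned:
  assumes p: "ti_over S p" and V: "is_view V" and \<phi>: "sentence \<phi>"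
    and D0: "D0 \<in> set_pmf p" "models D0 \<phi>"
    and A: "A = {D. models D \<phi>} - {D0}" "set_pmf p \<inter> A \<noteq> {}"
  obtains S' r U where "ti_over S' r" "is_view U" "fst U = fst V"
    "map_pmf (apply_view U) r = map_pmf (apply_view V) (cond_pmf p {D. models D \<phi>})"
    "\<And>D. instance_over S D \<Longrightarrow> D \<in> A \<Longrightarrow> \<exists>G. instance_over S' G \<and> apply_view U G = apply_view V D"
proof -
  let ?\<nu> = "map_pmf (apply_view V) (cond_pmf p A)" and ?\<delta> = "return_pmf (apply_view V D0)"
  let ?s = "measure_pmf.prob p A"
  define a where "a = pmf p D0 / measure_pmf.prob p {D. models D \<phi>}"
  have a: "0 < a" "a < 1"
    and target: "map_pmf (apply_view V) (cond_pmf p {D. models D \<phi>}) = mix a ?\<delta> ?\<nu>"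
    using pmf_map_cond_split[of D0 p "{D. models D \<phi>}"] D0 A unfolding a_def by auto
  have s: "0 < ?s" "?s \<le> 1"
    using A(2) by (auto intro: measure_pmf_posI)
  \<comment> \<open>The roots of \<open>a > 0\<close> tend to 1, so with enough rounds the
    acceptance probability required per round is below \<open>?s\<close>.\<close>
  obtain n where n: "1 - ?s < root (Suc n) a"
  proof -
    have "\<forall>\<^sub>F n in sequentially. 1 - ?s < root n a"
      using LIMSEQ_root_const[OF a(1)] s(1) by (intro order_tendstoD) auto
    then obtain N where "\<And>n. n \<ge> N \<Longrightarrow> 1 - ?s < root n a"
      unfolding eventually_sequentially by blast
    then show ?thesis using that[of N] le_SucI[OF order_refl] by blast
  qed
  \<comment> \<open>After \<open>n + 1\<close> rounds with acceptance probability \<open>t\<close> all have failed with probability exactly \<open>a\<close>.\<close>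
  define t where "t = 1 - root (Suc n) a"
  have t: "0 \<le> t" "t \<le> ?s" "(1 - t) ^ Suc n = a"
  proof -
    have "root (Suc n) a \<le> 1" "root (Suc n) a ^ Suc n = a"
      using a by (simp_all only: real_root_le_1_iff real_root_pow_pos zero_less_Suc less_imp_le)
    moreover have "1 - t = root (Suc n) a" by (simp add: t_def)
    ultimately show "0 \<le> t" "t \<le> ?s" "(1 - t) ^ Suc n = a"
      using n by (linarith, linarith, simp only:)
  qed
  have D0_inst: "instance_over S D0" "finite D0"
    using p D0 by (auto simp: ti_over_def instance_over_def)
  have step: "\<exists>S' r U. ti_over S' r \<and> is_view U \<and> fst U = fst V \<and>
      map_pmf (apply_view U) r = mix ((1 - t) ^ Suc k) ?\<delta> ?\<nu> \<and>
      (\<forall>D. instance_over S D \<and> D \<in> A \<longrightarrow> (\<exists>G. instance_over S' G \<and> apply_view U G = apply_view V D))"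
    if q: "ti_over T q" "is_view W" "fst W = fst V"
      "map_pmf (apply_view W) q = mix ((1 - t) ^ k) ?\<delta> ?\<nu>" for T q W k
  proof -
    have t1: "t \<le> 1" using t(2) s(2) by (rule order_trans)
    then have "0 \<le> (1 - t) ^ k" "(1 - t) ^ k \<le> 1"
      using t(1) by (simp_all add: power_le_one)
    then have "mix t ?\<nu> (mix ((1 - t) ^ k) ?\<delta> ?\<nu>) = mix ((1 - t) ^ Suc k) ?\<delta> ?\<nu>"
      using t(1) t1 by (subst mix_mix) auto
    \<comment> \<open>The bias \<open>t / ?s\<close> of the coin lowers the acceptance probability
      from \<open>?s\<close> to \<open>t\<close>; it is a probability because
      \<open>t \<le> ?s\<close>.\<close>
    moreover have "t / ?s * ?s = t" "0 \<le> t / ?s" "t / ?s \<le> 1"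
      using t s by auto
    ultimately have mix_eq: "mix (t / ?s * ?s) ?\<nu> (map_pmf (apply_view W) q) = mix ((1 - t) ^ Suc k) ?\<delta> ?\<nu>"
      and b: "0 \<le> t / ?s" "t / ?s \<le> 1"
      by (simp_all only: q(4))
    obtain S' r U where r: "ti_over S' r" "is_view U" "fst U = fst V"
      "map_pmf (apply_view U) r = mix (t / ?s * ?s) ?\<nu> (map_pmf (apply_view W) q)"
      and ex: "\<And>D. instance_over S D \<Longrightarrow> D \<in> A \<Longrightarrow> \<exists>G. instance_over S' G \<and> apply_view U G = apply_view V D"
      by (rule merge_step[OF p q(1) V q(2,3) \<phi> D0_inst(2) b A]) (rule that)
    have "\<forall>D. instance_over S D \<and> D \<in> A \<longrightarrow> (\<exists>G. instance_over S' G \<and> apply_view U G = apply_view V D)"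
      using ex by blast
    with r show ?thesis
      unfolding mix_eq by (intro exI[of _ S'] exI[of _ r] exI[of _ U] conjI)
  qed
  have "\<exists>T q W. ti_over T q \<and> is_view W \<and> fst W = fst V \<and>
      map_pmf (apply_view W) q = mix ((1 - t) ^ k) ?\<delta> ?\<nu>" for k
  proof (induction k)
    case 0
    \<comment> \<open>Zero rounds: \<open>D0\<close> is output with weight 1.\<close>
    have "ti_over S (return_pmf D0)"
      using p D0_inst by (simp add: ti_over_def)
    moreover have "mix ((1 - t) ^ 0) ?\<delta> ?\<nu> = ?\<delta>"
      by (rule pmf_eqI) (simp add: pmf_mix)
    ultimately show ?case
      using V by (intro exI[of _ S] exI[of _ "return_pmf D0"] exI[of _ V]) (simp only: map_return_pmf)
  next
    case (Suc k)
    then obtain T q W where "ti_over T q" "is_view W" "fst W = fst V"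
      "map_pmf (apply_view W) q = mix ((1 - t) ^ k) ?\<delta> ?\<nu>"
      by (elim exE conjE)
    from step[OF this] show ?case
      by (elim exE conjE) (intro exI conjI)
  qed
  \<comment> \<open>The induction carries distributions only. One last application of
    \<open>step\<close> raises the exponent to \<open>Suc n\<close> and also supplies preimages for
    the outputs of all instances in \<open>A\<close>.\<close>
  then obtain T q W where "ti_over T q" "is_view W" "fst W = fst V"
      "map_pmf (apply_view W) q = mix ((1 - t) ^ n) ?\<delta> ?\<nu>"
    by blast
  from step[OF this] obtain S' r U where r: "ti_over S' r" "is_view U" "fst U = fst V"
    "map_pmf (apply_view U) r = mix a ?\<delta> ?\<nu>"
    and ex: "\<forall>D. instance_over S D \<and> D \<in> A \<longrightarrow> (\<exists>G. instance_over S' G \<and> apply_view U G = apply_view V D)"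
    unfolding t(3) by (elim exE conjE)
  show ?thesis
  proof (rule that[OF r(1-3)])
    show "map_pmf (apply_view U) r = map_pmf (apply_view V) (cond_pmf p {D. models D \<phi>})"
      unfolding target by (rule r(4))
    show "\<exists>G. instance_over S' G \<and> apply_view U G = apply_view V D"
      if "instance_over S D" "D \<in> A" for D
      using ex that by blast
  qed
qed

section \<open>The two inclusions, including sample spaces\<close>

lemma condition_true:
  assumes "is_pdb I"
  shows "condition I TT = I" "measure_pmf.prob (snd I) {D \<in> fst I. models D TT} = 1"
proof -
  have TT: "models D TT" for D :: "'a inst"
    by (simp add: models_def TT_def)
  have "pmf (cond_pmf (snd I) UNIV) D = pmf (snd I) D" for D
    by (subst pmf_cond) (auto simp: set_pmf_not_empty)
  then show "condition I TT = I"
    by (simp add: condition_def TT prod_eq_iff pmf_eq_iff)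
  have "measure_pmf.prob (snd I) (fst I) = 1"
    using assms by (simp add: is_pdb_def measure_pmf.prob_eq_1 AE_measure_pmf_iff subset_eq)
  then show "measure_pmf.prob (snd I) {D \<in> fst I. models D TT} = 1"
    by (simp add: TT)
qed

lemma TI_subset_TI_cond_FO: "TI \<subseteq> TI_cond_FO"
proof
  fix I :: "'u pdb" assume I: "I \<in> TI"
  then have "is_pdb I" by (simp add: TI_def)
  note condition_true[OF this]
  moreover have "sentence TT" by (simp add: sentence_def TT_def)
  ultimately have "I = condition I TT \<and> I \<in> TI \<and> sentence TT \<and>
      measure_pmf.prob (snd I) {D \<in> fst I. models D TT} > 0"
    using I by (simp only: zero_less_one simp_thms)
  then show "I \<in> TI_cond_FO"
    unfolding TI_cond_FO_def by blast
qed

lemma FO_img_mono: "C \<subseteq> C' \<Longrightarrow> FO_img C \<subseteq> FO_img C'"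
  unfolding FO_img_def by blast

text \<open>Equality of PDBs concerns sample spaces as well as distributions, so outputs of
  instances of probability 0 must be attained too.\<close>

lemma image_condition_in_FO_img_TI:
  fixes I :: "'u::countable pdb"
  assumes I: "I \<in> TI" and \<phi>: "sentence \<phi>" and V: "is_view V"
    and pos: "measure_pmf.prob (snd I) {D \<in> fst I. models D \<phi>} > 0"
  shows "image_pdb V (condition I \<phi>) \<in> FO_img TI"
proof -
  let ?p = "snd I"
  obtain D0 where D0: "D0 \<in> set_pmf ?p" "D0 \<in> fst I" "models D0 \<phi>"
  proof -
    have "set_pmf ?p \<inter> {D \<in> fst I. models D \<phi>} \<noteq> {}"
      using pos measure_Int_set_pmf[of ?p "{D \<in> fst I. models D \<phi>}"] by (auto simp: Int_commute)
    then show ?thesis using that by blast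
  qed
  define A where "A = {D. models D \<phi>} - {D0}"
  show ?thesis
  proof (cases "set_pmf ?p \<inter> A = {}")
    case True
    then have "set_pmf ?p \<inter> {D. models D \<phi>} = {D0}"
      using D0 by (auto simp: A_def)
    from condition_point_mass_in_TI[OF I this] V show ?thesis
      unfolding FO_img_def by blast
  next
    case False
    obtain S where S: "schema S" "\<And>D. D \<in> fst I \<Longrightarrow> instance_over S D"
      and supp: "set_pmf ?p \<subseteq> fst I"
      using I by (auto simp: TI_def is_pdb_def)
    then have "ti_over S ?p"
      using I by (auto simp: ti_over_def TI_def tuple_independent_iff)
    then obtain S' r U where r: "ti_over S' r" and U: "is_view U" "fst U = fst V"
      and eq: "map_pmf (apply_view U) r = map_pmf (apply_view V) (cond_pmf ?p {D. models D \<phi>})"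
      and ex: "\<And>D. instance_over S D \<Longrightarrow> D \<in> A \<Longrightarrow> \<exists>G. instance_over S' G \<and> apply_view U G = apply_view V D"
      by (rule representable_conditioned[OF _ V \<phi> D0(1,3) A_def False]) (rule that)
    let ?X = "{D \<in> fst I. models D \<phi>}"
    \<comment> \<open>The largest sample space over \<open>S'\<close> whose image stays inside the
      wanted one.\<close>
    let ?Y = "{G. instance_over S' G \<and> apply_view U G \<in> apply_view V ` ?X}"
    have "set_pmf ?p \<inter> {D. models D \<phi>} \<noteq> {}" using D0 by blast
    then have set_eq: "apply_view U ` set_pmf r = apply_view V ` (set_pmf ?p \<inter> {D. models D \<phi>})"
      using arg_cong[OF eq, of set_pmf] by simp
    also have "\<dots> \<subseteq> apply_view V ` ?X"
      using supp by blast
    finally have r_sub: "set_pmf r \<subseteq> ?Y"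
      using r unfolding ti_over_def by blast
    \<comment> \<open>Countability of the universe enters here: there are only countably many finite
      sets of facts.\<close>
    have "countable ?Y"
      by (rule countable_subset[OF _ countable_Collect_finite]) (auto simp: instance_over_def)
    moreover from r_sub have "?Y \<noteq> {}"
      using set_pmf_not_empty[of r] by blast
    moreover note r_sub
    moreover have "schema S'" "ti_pmf r"
      using r by (simp_all add: ti_over_def)
    ultimately have TI: "(?Y, r) \<in> TI"
      unfolding TI_def is_pdb_def tuple_independent_iff by simp blast
    have "apply_view U ` ?Y = apply_view V ` ?X"
    proof
      show "apply_view V ` ?X \<subseteq> apply_view U ` ?Y"
      proof
        fix E assume "E \<in> apply_view V ` ?X"
        then obtain D where D: "D \<in> ?X" "E = apply_view V D" by blast
        show "E \<in> apply_view U ` ?Y"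
        \<comment> \<open>The output of \<open>D0\<close> is attained on the support of
          \<open>r\<close>, since \<open>D0\<close> has positive probability; any other
          \<open>D\<close> lies in \<open>A\<close>, where \<open>ex\<close> gives a
          preimage.\<close>
        proof (cases "D = D0")
          case True
          then have "E \<in> apply_view U ` set_pmf r"
            using D0 D(2) set_eq by blast
          then show ?thesis using r_sub by blast
        next
          case False
          then obtain G where "instance_over S' G" "apply_view U G = apply_view V D"
            using ex[of D] S(2) D(1) by (auto simp: A_def)
          then show ?thesis using D by (intro image_eqI[of _ _ G]) auto
        qed
      qed
    qed auto
    then have "image_pdb V (condition I \<phi>) = image_pdb U (?Y, r)"
      unfolding image_pdb_def condition_def fst_conv snd_conv eq by (simp only:)
    with TI U(1) show ?thesis
      unfolding FO_img_def by blast
  qed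
qed

theorem theorem4p1:
  assumes "infinite (UNIV :: 'u::countable set)"
  shows "FO_img (TI_cond_FO :: 'u pdb set) = FO_img (TI :: 'u pdb set)"
proof
  show "FO_img (TI_cond_FO :: 'u pdb set) \<subseteq> FO_img TI"
  proof
    fix J :: "'u pdb" assume "J \<in> FO_img TI_cond_FO"
    then obtain V I \<phi> where "J = image_pdb V (condition I \<phi>)" "is_view V" "I \<in> TI" "sentence \<phi>"
      "measure_pmf.prob (snd I) {D \<in> fst I. models D \<phi>} > 0"
      unfolding FO_img_def TI_cond_FO_def by blast
    then show "J \<in> FO_img TI"
      by (simp add: image_condition_in_FO_img_TI)
  qed
  show "FO_img (TI :: 'u pdb set) \<subseteq> FO_img TI_cond_FO"
    by (intro FO_img_mono TI_subset_TI_cond_FO)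
qed

end
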